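(* The closure of $\mathcal{P}_G$ in $C(G)$ (with respect to the supremum norm) is exactly $\mathcal{F}_1$, i.e. $\overline{\mathcal{P}_G}^{C(G)} = \mathcal{F}_1$.
   Context: $G := [0,1]$, and $C(G)$ is the Banach space of continuous real-valued functions on $G$ with the supremum norm $\|f\|_{C(G)} = \sup_{x\in G}|f(x)|$. $\mathcal{P}$ is the set of real-valued univariate polynomials $p$ satisfying: (i) $p(x)\in[0,1]$ for all $x\in G$; (ii) $p(x)\le 0$ for all $x\le 0$; (iii) $p(x)\ge 1$ for all $x\ge 1$. $\mathcal{P}_G := \{p|_G : p\in\mathcal{P}\}\subseteq C(G)$. $\mathcal{F}_1$ is the set of all $f\in C(G)$ such that $f(0)=0$, $f(1)=1$, and $0\le f(x)\le 1$ for all $x\in G$. *)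

theory Defs
  imports "HOL-Analysis.Analysis" "HOL-Computational_Algebra.Polynomial"
begin

definition G :: "real set" where
  "G = {0..1}"

text \<open>
  Elements of the library's \<^const>\<open>cfunspace\<close> are functions on the whole type that take the value
  \<^const>\<open>undefined\<close> outside the domain; this makes them correspond one-to-one to functions on \<open>G\<close>.
\<close>
definition CG :: "(real \<Rightarrow> real) metric" where
  "CG = cfunspace (top_of_set G) euclidean_metric"

lemma mspace_CG: "mspace CG = {f \<in> extensional G. continuous_on G f}"
proof -
  have "bounded (f ` G)" if "continuous_on G f" for f :: "real \<Rightarrow> real"
    using compact_continuous_image[OF that] by (simp add: G_def compact_imp_bounded)
  then show ?thesis
    by (auto simp: CG_def)
qed

lemma mdist_CG:
  assumes "f \<in> mspace CG" "g \<in> mspace CG"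
  shows "mdist CG f g = (SUP x\<in>G. \<bar>f x - g x\<bar>)"
  using assms
  by (auto simp: CG_def mdist_cfunspace_eq_mdist_funspace Met_TC.fdist_def
      Met_TC.fspace_def dist_real_def G_def)

definition P :: "real poly set" where
  "P = {p. (\<forall>x\<in>G. poly p x \<in> {0..1}) \<and> (\<forall>x\<le>0. poly p x \<le> 0) \<and> (\<forall>x\<ge>1. poly p x \<ge> 1)}"

definition P_G :: "(real \<Rightarrow> real) set" where
  "P_G = (\<lambda>p. restrict (poly p) G) ` P"

lemma P_G_subset: "P_G \<subseteq> mspace CG"
  by (auto simp: P_G_def mspace_CG intro!: continuous_intros)

definition F1 :: "(real \<Rightarrow> real) set" where
  "F1 = {f \<in> mspace CG. f 0 = 0 \<and> f 1 = 1 \<and> (\<forall>x\<in>G. 0 \<le> f x \<and> f x \<le> 1)}"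

end

theory Submission
  imports Defs
begin

text \<open>
  One inclusion holds because every condition in the definition of \<open>F1\<close> is preserved by limits and
  \<open>p \<in> P\<close> forces \<open>p(0) = 0\<close> and \<open>p(1) = 1\<close>.

  For density, take \<open>f \<in> F1\<close>. A Bernstein polynomial \<open>r\<close> of high degree is close to \<open>f\<close> on \<open>[0,1]\<close>,
  takes values in \<open>[0,1]\<close> there, and agrees with \<open>f\<close> at both end points; only its behaviour outside
  \<open>[0,1]\<close> is uncontrolled. This is repaired by mixing in a little of
  \<open>S\<^sub>N(x) = (1 + (2x - 1)\<^sup>N) / 2\<close> with \<open>N\<close> odd: the polynomial \<open>p = (1 - a) r + a S\<^sub>N\<close> with small \<open>a > 0\<close>
  is on \<open>[0,1]\<close> a convex combination of functions with values in \<open>[0,1]\<close>, so it stays in range and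
  is within \<open>a\<close> of \<open>r\<close>, \<^emph>\<open>independently of\<close> \<open>N\<close>. Outside \<open>[0,1]\<close> the
  polynomial \<open>S\<^sub>N\<close> is at most \<open>0\<close> on the left and at least \<open>1\<close> on the right, and as \<open>N\<close> grows with \<open>a\<close> and \<open>r\<close> fixed, \<open>a S\<^sub>N\<close> overwhelms \<open>r\<close>:
  at infinity by its degree, and at the end points \<open>0\<close> and \<open>1\<close>, where \<open>r\<close> and \<open>r - 1\<close>
  respectively vanish, by its slope, which is \<open>N\<close>. The lemma \<open>eventually_power_dominates_poly\<close> makes this uniform, and
  \<open>blend_steep_in_P\<close> draws the conclusion.
\<close>

section \<open>Powers dominate polynomials beyond a common zero at 1\<close>

text \<open>
  The function \<open>u\<^sup>d\<^sup>+\<^sup>m - 1\<close> controls both regimes at once: the factor \<open>u - 1\<close> with slope \<open>m\<close> as \<open>u \<rightarrow> 1\<close>,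
  and growth of order \<open>d\<close> as \<open>u \<rightarrow> \<infinity>\<close>. It is Bernoulli's inequality for \<open>u\<^sup>m\<close>, multiplied by \<open>u\<^sup>d\<close>.
\<close>
lemma power_minus_one_ge:
  fixes u :: real
  assumes "u \<ge> 1"
  shows "real m * (u - 1) * u ^ d \<le> u ^ (d + m) - 1"
proof -
  have "real m * (u - 1) \<le> u ^ m - 1"
    using Bernoulli_inequality[of "u - 1" m] assms by (simp add: algebra_simps)
  then have "real m * (u - 1) * u ^ d \<le> (u ^ m - 1) * u ^ d"
    using assms by (intro mult_right_mono) auto
  also have "\<dots> = u ^ (d + m) - u ^ d"
    by (simp add: algebra_simps power_add)
  also have "\<dots> \<le> u ^ (d + m) - 1"
    using assms by (simp add: one_le_power)
  finally show ?thesis .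
qed

lemma poly_growth_bound:
  fixes s :: "real poly"
  shows "\<exists>K d. \<forall>u\<ge>1. \<bar>poly s u\<bar> \<le> K * u ^ d"
proof (intro exI allI impI)
  fix u :: real
  assume u: "u \<ge> 1"
  have "\<bar>poly s u\<bar> \<le> (\<Sum>i\<le>degree s. \<bar>coeff s i * u ^ i\<bar>)"
    unfolding poly_altdef by (rule sum_abs)
  also have "\<dots> \<le> (\<Sum>i\<le>degree s. \<bar>coeff s i\<bar> * u ^ degree s)"
    using u by (intro sum_mono) (auto simp: abs_mult intro!: mult_left_mono power_increasing)
  also have "\<dots> = (\<Sum>i\<le>degree s. \<bar>coeff s i\<bar>) * u ^ degree s"
    by (simp add: sum_distrib_right)
  finally show "\<bar>poly s u\<bar> \<le> (\<Sum>i\<le>degree s. \<bar>coeff s i\<bar>) * u ^ degree s" .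
qed

text \<open>
  Splitting off the zero, \<open>q = (u - 1) s\<close> is at most \<open>K (u - 1) u\<^sup>d\<close>, and any exponent \<open>N \<ge> d + m\<close>
  with \<open>m \<ge> K / e\<close> then works by \<open>power_minus_one_ge\<close>.
\<close>
lemma eventually_power_dominates_poly:
  fixes q :: "real poly"
  assumes "poly q 1 = 0" "e > 0"
  shows "\<forall>\<^sub>F N in sequentially. \<forall>u\<ge>1. \<bar>poly q u\<bar> \<le> e * (u ^ N - 1)"
proof -
  obtain s where s: "q = [:-1, 1:] * s"
    using assms(1) by (auto simp: poly_eq_0_iff_dvd dvd_def)
  obtain K d where K: "\<And>u. u \<ge> 1 \<Longrightarrow> \<bar>poly s u\<bar> \<le> K * u ^ d"
    using poly_growth_bound[of s] by blast
  obtain m :: nat where m: "K / e \<le> real m"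
    using real_arch_simple by blast
  have "\<bar>poly q u\<bar> \<le> e * (u ^ N - 1)" if N: "N \<ge> d + m" and u: "u \<ge> 1" for N and u :: real
  proof -
    have "\<bar>poly q u\<bar> = (u - 1) * \<bar>poly s u\<bar>"
    proof -
      have "poly q u = (u - 1) * poly s u"
        by (simp add: s algebra_simps)
      then show ?thesis
        using u by (simp add: abs_mult)
    qed
    also have "\<dots> \<le> (u - 1) * (K * u ^ d)"
      using u K by (intro mult_left_mono) auto
    also have "\<dots> \<le> (u - 1) * ((e * real m) * u ^ d)"
      using u m \<open>e > 0\<close> by (intro mult_left_mono mult_right_mono) (auto simp: field_simps)
    also have "\<dots> = e * (real m * (u - 1) * u ^ d)"
      by simp
    also have "\<dots> \<le> e * (u ^ (d + m) - 1)"
      using \<open>e > 0\<close> by (intro mult_left_mono power_minus_one_ge u) auto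
    also have "\<dots> \<le> e * (u ^ N - 1)"
      using \<open>e > 0\<close> u N by (intro mult_left_mono diff_right_mono power_increasing) auto
    finally show ?thesis .
  qed
  then show ?thesis
    unfolding eventually_sequentially by blast
qed

section \<open>Repairing the signs outside the unit interval\<close>

definition steep :: "nat \<Rightarrow> real poly" where
  "steep N = smult (1/2) (1 + [:-1, 2:] ^ N)"

lemma poly_steep: "poly (steep N) x = (1 + (2 * x - 1) ^ N) / 2"
  by (simp add: steep_def algebra_simps)

lemma poly_steep_unit:
  assumes "x \<in> {0..1}"
  shows "poly (steep N) x \<in> {0..1}"
proof -
  have "\<bar>(2 * x - 1) ^ N\<bar> \<le> 1"
    unfolding power_abs using assms by (intro power_le_one) auto
  then show ?thesis
    by (auto simp: poly_steep)
qed

text \<open>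
  The bounds inside \<open>[0,1]\<close> hold for every \<open>N\<close> by convexity. For \<open>x \<le> 0\<close> put \<open>u = 1 - 2x \<ge> 1\<close>; as \<open>N\<close> is
  odd, \<open>a S\<^sub>N(x) = -a (u\<^sup>N - 1) / 2\<close>, which is to dominate \<open>r(x)\<close>. For \<open>x \<ge> 1\<close> put \<open>u = 2x - 1 \<ge> 1\<close>; then
  \<open>a (S\<^sub>N(x) - 1) = a (u\<^sup>N - 1) / 2\<close>, which is to dominate \<open>r(x) - 1\<close>. In the variable \<open>u\<close> both
  polynomials vanish at \<open>u = 1\<close>.
\<close>
lemma blend_steep_in_P:
  assumes r01: "poly r 0 = 0" "poly r 1 = 1"
    and unit: "\<And>x. x \<in> {0..1} \<Longrightarrow> poly r x \<in> {0..1}"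
    and a: "0 < a" "a < 1"
  shows "\<exists>N. smult (1 - a) r + smult a (steep N) \<in> P"
proof -
  (* r(x) in terms of u = 1 - 2x, and r(x) - 1 in terms of u = 2x - 1 *)
  define q where "q = r \<circ>\<^sub>p [:1/2, -1/2:]"
  define q' where "q' = r \<circ>\<^sub>p [:1/2, 1/2:] - 1"
  have "\<forall>\<^sub>F N in sequentially. (\<forall>u\<ge>1. \<bar>poly q u\<bar> \<le> a/2 * (u ^ N - 1))
      \<and> (\<forall>u\<ge>1. \<bar>poly q' u\<bar> \<le> a/2 * (u ^ N - 1))"
    using r01 a
    by (intro eventually_conj eventually_power_dominates_poly)
      (auto simp: q_def q'_def poly_pcompose)
  then obtain M where M: "\<And>N. N \<ge> M \<Longrightarrow> (\<forall>u\<ge>1. \<bar>poly q u\<bar> \<le> a/2 * (u ^ N - 1))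
      \<and> (\<forall>u\<ge>1. \<bar>poly q' u\<bar> \<le> a/2 * (u ^ N - 1))"
    unfolding eventually_sequentially by blast
  (* an odd exponent beyond M *)
  define N where "N = 2 * M + 1"
  have "odd N" "N \<ge> M"
    by (auto simp: N_def)
  define p where "p = smult (1 - a) r + smult a (steep N)"
  have p: "poly p x = (1 - a) * poly r x + a * ((1 + (2 * x - 1) ^ N) / 2)" for x
    by (simp add: p_def poly_steep)
  have damp: "\<bar>(1 - a) * z\<bar> \<le> \<bar>z\<bar>" for z :: real
    using a by (simp add: abs_mult mult_left_le_one_le)
  have "poly p x \<in> {0..1}" if "x \<in> G" for x
    using convexD[of "{0..1::real}" "poly r x" "poly (steep N) x" "1 - a" a]
      unit[of x] poly_steep_unit[of x N] that a by (auto simp: p_def G_def)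
  moreover have "poly p x \<le> 0" if "x \<le> 0" for x
  proof -
    have "\<bar>poly q (1 - 2 * x)\<bar> \<le> a/2 * ((1 - 2 * x) ^ N - 1)"
      using M[OF \<open>N \<ge> M\<close>] that by simp
    moreover have "poly q (1 - 2 * x) = poly r x"
      by (simp add: q_def poly_pcompose field_simps)
    moreover have "(1 - a) * poly r x \<le> \<bar>poly r x\<bar>"
      using damp[of "poly r x"] by linarith
    moreover have "(1 - 2 * x) ^ N = - ((2 * x - 1) ^ N)"
      using power_minus_odd[OF \<open>odd N\<close>, of "2 * x - 1"] by simp
    ultimately show ?thesis
      by (simp add: p field_simps)
  qed
  moreover have "poly p x \<ge> 1" if "x \<ge> 1" for x
  proof -
    have "\<bar>poly q' (2 * x - 1)\<bar> \<le> a/2 * ((2 * x - 1) ^ N - 1)"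
      using M[OF \<open>N \<ge> M\<close>] that by simp
    moreover have "poly q' (2 * x - 1) = poly r x - 1"
      by (simp add: q'_def poly_pcompose field_simps)
    moreover have "- \<bar>poly r x - 1\<bar> \<le> (1 - a) * (poly r x - 1)"
      using damp[of "poly r x - 1"] by linarith
    ultimately have "(1 - a) * (poly r x - 1) + a/2 * ((2 * x - 1) ^ N - 1) \<ge> 0"
      by linarith
    then show ?thesis
      by (simp add: p field_simps)
  qed
  ultimately have "p \<in> P"
    by (simp add: P_def)
  then show ?thesis
    unfolding p_def by blast
qed

section \<open>Bernstein polynomials as a first approximation\<close>

text \<open>
  Bernstein polynomials are used, rather than an arbitrary polynomial supplied by the Weierstrass
  theorem, because they take averages of values of \<open>f\<close>, hence respect the range \<open>[0,1]\<close>, and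
  interpolate \<open>f\<close> at the end points.
\<close>
lemma Bernstein_approximant:
  assumes cont: "continuous_on {0..1} f" and f01: "f 0 = 0" "f 1 = 1"
    and unit: "\<And>x. x \<in> {0..1} \<Longrightarrow> f x \<in> {0..1}" and "e > 0"
  obtains r :: "real poly" where "poly r 0 = 0" "poly r 1 = 1"
    "\<And>x. x \<in> {0..1} \<Longrightarrow> poly r x \<in> {0..1}"
    "\<And>x. x \<in> {0..1} \<Longrightarrow> \<bar>f x - poly r x\<bar> < e"
proof -
  obtain M where M: "\<And>n x. M \<le> n \<Longrightarrow> x \<in> {0..1} \<Longrightarrow>
      \<bar>f x - (\<Sum>k\<le>n. f (real k / real n) * Bernstein n k x)\<bar> < e"
    using Bernstein_Weierstrass[OF cont \<open>e > 0\<close>] by blast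
  (* the degree must be positive for k / n = 1 at k = n *)
  define n where "n = Suc M"
  define r where "r = (\<Sum>k\<le>n. smult (f (real k / real n) * real (n choose k))
      ([:0, 1:] ^ k * [:1, -1:] ^ (n - k)))"
  have r: "poly r x = (\<Sum>k\<le>n. f (real k / real n) * Bernstein n k x)" for x
    by (simp add: r_def poly_sum Bernstein_def mult.assoc)
  have fk: "f (real k / real n) \<in> {0..1}" if "k \<le> n" for k
    using that by (intro unit) (auto simp: n_def)
  show ?thesis
  proof
    have "poly r 0 = (\<Sum>k\<in>{0}. f (real k / real n) * Bernstein n k 0)"
      unfolding r by (rule sum.mono_neutral_right) (auto simp: Bernstein_def)
    then show "poly r 0 = 0"
      by (simp add: f01)
    have "poly r 1 = (\<Sum>k\<in>{n}. f (real k / real n) * Bernstein n k 1)"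
      unfolding r by (rule sum.mono_neutral_right) (auto simp: Bernstein_def)
    then show "poly r 1 = 1"
      by (simp add: f01 Bernstein_def n_def del: of_nat_Suc)
  next
    fix x :: real
    assume x: "x \<in> {0..1}"
    then have nonneg: "Bernstein n k x \<ge> 0" for k
      by (simp add: Bernstein_nonneg)
    have "poly r x \<ge> 0"
      unfolding r using fk nonneg by (auto intro!: sum_nonneg)
    moreover have "poly r x \<le> (\<Sum>k\<le>n. Bernstein n k x)"
      unfolding r using fk nonneg by (intro sum_mono mult_left_le_one_le) auto
    ultimately show "poly r x \<in> {0..1}"
      by simp
    show "\<bar>f x - poly r x\<bar> < e"
      unfolding r using M[of n x] x by (simp add: n_def)
  qed
qed

section \<open>Closure in the supremum norm\<close>

lemma mdist_CG_le_iff: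
  assumes "f \<in> mspace CG" "g \<in> mspace CG"
  shows "mdist CG f g \<le> c \<longleftrightarrow> (\<forall>x\<in>G. \<bar>f x - g x\<bar> \<le> c)"
proof -
  have "continuous_on G (\<lambda>x. \<bar>f x - g x\<bar>)"
    using assms by (auto simp: mspace_CG intro!: continuous_intros)
  then have "compact ((\<lambda>x. \<bar>f x - g x\<bar>) ` G)"
    by (rule compact_continuous_image) (simp add: G_def)
  then have "bdd_above ((\<lambda>x. \<bar>f x - g x\<bar>) ` G)"
    by (intro bounded_imp_bdd_above compact_imp_bounded)
  then show ?thesis
    unfolding mdist_CG[OF assms] by (intro cSUP_le_iff) (auto simp: G_def)
qed

text \<open>
  The non-strict bound is what a supremum can be tested against point by point; it describes the
  same closure as the strict one of open balls because \<open>e\<close> is arbitrary.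
\<close>
lemma closure_of_CG_iff:
  assumes "S \<subseteq> mspace CG"
  shows "f \<in> mtopology_of CG closure_of S \<longleftrightarrow>
    f \<in> mspace CG \<and> (\<forall>e>0. \<exists>g\<in>S. \<forall>x\<in>G. \<bar>f x - g x\<bar> \<le> e)" (is "?L \<longleftrightarrow> ?R")
proof -
  have "?L \<longleftrightarrow> f \<in> mspace CG \<and> (\<forall>e>0. \<exists>g\<in>S. mdist CG f g < e)"
    using assms
    unfolding mtopology_of_def Metric_space.metric_closure_of[OF Metric_space_mspace_mdist]
    by (auto simp: Metric_space.in_mball[OF Metric_space_mspace_mdist] subset_iff)
  also have "\<dots> \<longleftrightarrow> f \<in> mspace CG \<and> (\<forall>e>0. \<exists>g\<in>S. mdist CG f g \<le> e)"
    by (meson dense le_less_trans less_imp_le)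
  also have "\<dots> \<longleftrightarrow> ?R"
    using assms mdist_CG_le_iff by (smt (verit) subsetD)
  finally show ?thesis .
qed

lemma P_G_subset_F1: "P_G \<subseteq> F1"
proof
  fix g
  assume "g \<in> P_G"
  then obtain p where p: "p \<in> P" and g: "g = restrict (poly p) G"
    by (auto simp: P_G_def)
  have G: "0 \<in> G" "1 \<in> G"
    by (auto simp: G_def)
  have "poly p 0 \<le> 0" "poly p 1 \<ge> 1" "\<And>x. x \<in> G \<Longrightarrow> poly p x \<in> {0..1}"
    using p by (auto simp: P_def)
  moreover from this(3)[of 0] this(3)[of 1] have "0 \<le> poly p 0" "poly p 1 \<le> 1"
    using G by auto
  ultimately show "g \<in> F1"
    using G P_G_subset \<open>g \<in> P_G\<close> by (auto simp: F1_def g)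
qed

theorem theorem2p2:
  shows "(mtopology_of CG) closure_of P_G = F1"
proof (intro subset_antisym subsetI)
  fix f
  assume "f \<in> mtopology_of CG closure_of P_G"
  then have f: "f \<in> mspace CG"
    and approx: "\<And>e. e > 0 \<Longrightarrow> \<exists>g\<in>F1. \<forall>x\<in>G. \<bar>f x - g x\<bar> \<le> e"
    unfolding closure_of_CG_iff[OF P_G_subset] using P_G_subset_F1 by blast+
  (* all conditions defining F1 are pointwise, so approximation at a single point suffices *)
  have near: "\<exists>y. \<bar>f x - y\<bar> \<le> e \<and> 0 \<le> y \<and> y \<le> 1 \<and> (x = 0 \<longrightarrow> y = 0) \<and> (x = 1 \<longrightarrow> y = 1)"
    if "x \<in> G" "e > 0" for x e
    using approx[OF \<open>e > 0\<close>] that by (auto simp: F1_def)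
  have "f 0 = 0"
    using near[of 0 "\<bar>f 0\<bar> / 2"] by (force simp: G_def)
  moreover have "f 1 = 1"
    using near[of 1 "\<bar>f 1 - 1\<bar> / 2"] by (force simp: G_def)
  moreover have "0 \<le> f x \<and> f x \<le> 1" if x: "x \<in> G" for x
  proof
    show "0 \<le> f x"
      using near[OF x, of "- f x / 2"] by force
    show "f x \<le> 1"
    proof (rule ccontr)
      assume "\<not> f x \<le> 1"
      then obtain y where "\<bar>f x - y\<bar> \<le> (f x - 1) / 2" "y \<le> 1"
        using near[OF x, of "(f x - 1) / 2"] by auto
      then show False
        using \<open>\<not> f x \<le> 1\<close> by argo
    qed
  qed
  ultimately show "f \<in> F1"
    using f by (simp add: F1_def)
next
  fix f
  assume "f \<in> F1"
  then have f: "f \<in> mspace CG" "continuous_on {0..1} f" "f 0 = 0" "f 1 = 1"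
    and unit: "\<And>x. x \<in> {0..1} \<Longrightarrow> f x \<in> {0..1}"
    by (auto simp: F1_def mspace_CG G_def)
  have "\<exists>g\<in>P_G. \<forall>x\<in>G. \<bar>f x - g x\<bar> \<le> e" if "e > 0" for e
  proof -
    (* half of the error is spent on r, half on mixing in the steep polynomial *)
    define a where "a = min (e/2) (1/2)"
    have a: "0 < a" "a < 1" "a \<le> e/2"
      using \<open>e > 0\<close> by (auto simp: a_def)
    obtain r where r: "poly r 0 = 0" "poly r 1 = 1"
      "\<And>x. x \<in> {0..1} \<Longrightarrow> poly r x \<in> {0..1}"
      "\<And>x. x \<in> {0..1} \<Longrightarrow> \<bar>f x - poly r x\<bar> < e/2"
      using Bernstein_approximant[OF f(2-4) unit, of "e/2"] \<open>e > 0\<close> by auto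
    obtain N where N: "smult (1 - a) r + smult a (steep N) \<in> P" (is "?p \<in> P")
      using blend_steep_in_P[OF r(1-3) a(1,2)] by blast
    have "\<bar>f x - poly ?p x\<bar> \<le> e" if "x \<in> G" for x
    proof -
      have x: "x \<in> {0..1}"
        using that by (simp add: G_def)
      have "\<bar>poly (steep N) x - poly r x\<bar> \<le> 1"
        using r(3)[OF x] poly_steep_unit[OF x, of N] by (auto simp: abs_le_iff)
      then have "a * \<bar>poly (steep N) x - poly r x\<bar> \<le> a"
        using a by (intro mult_left_le) auto
      moreover have "poly ?p x - poly r x = a * (poly (steep N) x - poly r x)"
        by (simp add: algebra_simps)
      then have "\<bar>poly ?p x - poly r x\<bar> = a * \<bar>poly (steep N) x - poly r x\<bar>"
        using a by (simp only: abs_mult abs_of_pos)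
      ultimately have "\<bar>poly ?p x - poly r x\<bar> \<le> e/2"
        using a by linarith
      then show ?thesis
        using r(4)[OF x] by linarith
    qed
    then show ?thesis
      using N by (intro bexI[of _ "restrict (poly ?p) G"]) (auto simp only: P_G_def restrict_apply' imageI)
  qed
  then show "f \<in> mtopology_of CG closure_of P_G"
    unfolding closure_of_CG_iff[OF P_G_subset] using f(1) by blast
qed

end
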